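(* Let $n = p_1^{k_1} p_2^{k_2} \cdots p_r^{k_r}$ be the prime factorization of a positive integer $n$, with distinct primes $p_i$ and integers $k_i \ge 1$, and let $D = \prod_{i=1}^r (k_i+1)$ be the number of divisors of $n$. Then the Wiener index of the divisor prime graph $G_{Dp(n)}$ is $$W(G_{Dp(n)}) = D(D-1) - \frac{1}{2}\left( \prod_{i=1}^r (2k_i + 1) - 1 \right).$$
   Context: For a positive integer $n$, the divisor prime graph $G_{Dp(n)}$ is the simple graph whose vertex set is the set of positive divisors of $n$, in which two distinct vertices $x, y$ are adjacent if and only if $\gcd(x,y) = 1$ (no loops). For a connected graph $G$, $d(u,v)$ denotes the shortest-path distance, and the Wiener index is $W(G) = \sum_{\{u,v\}} d(u,v)$, the sum over all unordered pairs of distinct vertices. *)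

theory Defs
  imports
    "Graph_Theory.Pair_Digraph"
    "Graph_Theory.Shortest_Path"
    "HOL-Computational_Algebra.Primes"
begin

text \<open>
  A simple graph is a finite, symmetric, loop-free digraph without parallel arcs (locale
  \<^locale>\<open>graph\<close>): an edge between \<open>u\<close> and \<open>v\<close> is the pair of arcs \<open>(u, v)\<close>, \<open>(v, u)\<close>.
\<close>

definition divisor_prime_graph :: "nat \<Rightarrow> nat pair_pre_digraph" where
  "divisor_prime_graph n =
     \<lparr> pverts = {d. d dvd n},
       parcs = {(x, y). x dvd n \<and> y dvd n \<and> x \<noteq> y \<and> gcd x y = 1} \<rparr>"

lemma graph_divisor_prime_graph:
  assumes "n > 0"
  shows "graph (with_proj (divisor_prime_graph n))"
proof -
  let ?V = "{d. d dvd n}" and ?E = "{(x, y). x dvd n \<and> y dvd n \<and> x \<noteq> y \<and> gcd x y = 1}"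
  have V: "finite ?V"
    using assms by simp
  have "?E \<subseteq> ?V \<times> ?V"
    by blast
  with V have E: "finite ?E"
    by (meson finite_SigmaI finite_subset)
  have "sym ?E"
    by (auto simp: sym_def gcd.commute)
  then have "pair_graph (divisor_prime_graph n)"
    using V E by unfold_locales (auto simp: divisor_prime_graph_def symmetric_def)
  then show ?thesis
    by (rule pair_graph.pair_graphD_graph)
qed

text \<open>
  The shortest-path distance is the infimum of the lengths of the walks, that is, the weighted
  distance for unit weights. It is \<open>\<infinity>\<close> if there is no walk, so that a Wiener
  index can only be finite if the graph is connected.
\<close>

definition (in wf_digraph) path_dist :: "'a \<Rightarrow> 'a \<Rightarrow> ereal" where
  "path_dist u v = \<mu> (\<lambda>_. 1) u v"

lemma (in sym_digraph) path_dist_commute: "path_dist u v = path_dist v u"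
proof -
  have rev: "\<exists>q. awalk v q u \<and> length q = length p" if "awalk u p v" for u p v
    using that
  proof (induction p arbitrary: u)
    case Nil
    then show ?case by (auto simp: awalk_Nil_iff)
  next
    case (Cons a p)
    then have a: "a \<in> arcs G" "tail G a = u" and "awalk (head G a) p v"
      by (auto simp: awalk_Cons_iff)
    with Cons.IH obtain q where q: "awalk v q (head G a)" "length q = length p"
      by blast
    have "(tail G a, head G a) \<in> arcs_ends G"
      using a by (auto simp: arcs_ends_conv)
    then have "(head G a, tail G a) \<in> arcs_ends G"
      using sym_arcs by (auto simp: symmetric_def sym_def)
    then obtain b where b: "b \<in> arcs G" "tail G b = head G a" "head G b = u"
      using a by (auto simp: arcs_ends_conv)
    then have "awalk (head G a) [b] u"
      by (auto simp: awalk_Cons_iff awalk_Nil_iff)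
    with q have "awalk v (q @ [b]) u"
      by (blast intro: awalk_appendI)
    with q(2) show ?case
      by (intro exI[of _ "q @ [b]"]) simp
  qed
  have cost: "awalk_cost (\<lambda>_. 1) p = length p" for p :: "'b awalk"
    by (induction p) auto
  have "path_dist v u \<le> path_dist u v" for u v
    unfolding path_dist_def \<mu>_def cost using rev[of u _ v] by (intro INF_mono) force
  then show ?thesis
    by (intro antisym)
qed

text \<open>
  The summation index ranges over the two-element sets of vertices; by
  \<open>path_dist_commute\<close> the choice of the order of \<open>u\<close> and \<open>v\<close> does not matter, so the
  description below is uniquely satisfied.
\<close>

definition (in graph) Wiener_index :: ereal where
  "Wiener_index =
     (\<Sum>e | e \<subseteq> verts G \<and> card e = 2. THE d. \<exists>u v. e = {u, v} \<and> d = path_dist u v)"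

lemma (in graph) the_path_dist:
  "(THE d. \<exists>x y. {u, v} = {x, y} \<and> d = path_dist x y) = path_dist u v"
  by (rule the_equality) (auto simp: doubleton_eq_iff path_dist_commute)

end

theory Submission
  imports Defs
begin

text \<open>
  Two distinct divisors are at distance 1 if they are coprime and at distance 2 otherwise, through
  the divisor 1. So the Wiener index is twice the number of pairs of divisors minus the number of
  coprime pairs. The number of ordered coprime pairs (which contain only one diagonal pair,
  \<open>(1, 1)\<close>) is multiplicative in \<open>n\<close>, and it is \<open>2 k + 1\<close> for a prime power \<open>p ^ k\<close>.
\<close>

section \<open>Divisors and coprime pairs of divisors of a product\<close>

definition coprime_divisor_pairs :: "nat \<Rightarrow> (nat \<times> nat) set" where
  "coprime_divisor_pairs n = {(x, y). x dvd n \<and> y dvd n \<and> coprime x y}"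

lemma finite_coprime_divisor_pairs:
  assumes "n > 0"
  shows "finite (coprime_divisor_pairs n)"
  by (rule finite_subset[of _ "{d. d dvd n} \<times> {d. d dvd n}"])
    (use assms in \<open>auto simp: coprime_divisor_pairs_def\<close>)

text \<open>Since \<open>z\<close> divides \<open>b\<close>, it shares no factor with
  \<open>a\<close>, so the gcd with \<open>a\<close> discards it. Thus a product remembers its
  \<open>a\<close>-part, which makes the splitting of divisors of \<open>a * b\<close>
  unique.\<close>

lemma gcd_mult_coprime_parts:
  fixes a b x z :: nat
  assumes "coprime a b" "x dvd a" "z dvd b"
  shows "gcd (x * z) a = x"
proof -
  have "coprime a z"
    using assms by (meson coprime_divisors dvd_refl)
  then have "gcd (x * z) a = gcd x a"
    by (metis gcd_mult_right_right_cancel gcd.commute)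
  with assms(2) show ?thesis
    by (simp add: gcd_nat.absorb1)
qed

lemma inj_on_mult_divisors:
  fixes a b :: nat
  assumes "coprime a b"
  shows "inj_on (\<lambda>(x, z). x * z) ({x. x dvd a} \<times> {z. z dvd b})"
proof (rule inj_onI, clarsimp)
  fix x z x' z' assume *: "x dvd a" "z dvd b" "x' dvd a" "z' dvd b" "x * z = x' * z'"
  \<comment> \<open>The gcd with \<open>a\<close> recovers the first factor and the gcd with
    \<open>b\<close> the second, so coprimality is used in both orders.\<close>
  have "coprime b a"
    using assms by (simp add: coprime_commute)
  then show "x = x' \<and> z = z'"
    using * assms by (metis gcd_mult_coprime_parts mult.commute)
qed

lemma mult_image_divisors:
  fixes a b :: nat
  shows "(\<lambda>(x, z). x * z) ` ({x. x dvd a} \<times> {z. z dvd b}) = {d. d dvd a * b}"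
proof (intro equalityI subsetI)
  fix d assume "d \<in> {d. d dvd a * b}"
  then obtain x z where "d = x * z" "x dvd a" "z dvd b"
    by (auto elim: dvd_productE)
  then show "d \<in> (\<lambda>(x, z). x * z) ` ({x. x dvd a} \<times> {z. z dvd b})"
    by (intro rev_image_eqI[of "(x, z)"]) simp_all
qed (auto simp: mult_dvd_mono)

lemma card_divisors_mult:
  fixes a b :: nat
  assumes "coprime a b"
  shows "card {d. d dvd a * b} = card {d. d dvd a} * card {d. d dvd b}"
  unfolding mult_image_divisors[symmetric]
  by (simp add: card_image inj_on_mult_divisors[OF assms] card_cartesian_product)

text \<open>Each component of a pair splits uniquely into an \<open>a\<close>-part and a
  \<open>b\<close>-part. Parts from different sides are always coprime, so two products are coprime
  exactly if their \<open>a\<close>-parts are and their \<open>b\<close>-parts are. This gives the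
  bijection \<open>?f\<close>.\<close>

lemma card_coprime_divisor_pairs_mult:
  assumes "coprime a b"
  shows "card (coprime_divisor_pairs (a * b)) =
    card (coprime_divisor_pairs a) * card (coprime_divisor_pairs b)"
proof -
  let ?f = "\<lambda>((x, y), (z, w)). (x * z, y * w :: nat)"
  let ?X = "coprime_divisor_pairs a \<times> coprime_divisor_pairs b"
  have "inj_on ?f ?X"
  proof (rule inj_onI)
    fix s t assume st: "s \<in> ?X" "t \<in> ?X" "?f s = ?f t"
    obtain x y z w x' y' z' w' where eq: "s = ((x, y), (z, w))" "t = ((x', y'), (z', w'))"
      by (metis surj_pair)
    have "(x, z) = (x', z')"
      by (rule inj_onD[OF inj_on_mult_divisors[OF assms]])
        (use st in \<open>auto simp: eq coprime_divisor_pairs_def\<close>)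
    moreover have "(y, w) = (y', w')"
      by (rule inj_onD[OF inj_on_mult_divisors[OF assms]])
        (use st in \<open>auto simp: eq coprime_divisor_pairs_def\<close>)
    ultimately show "s = t"
      unfolding eq by simp
  qed
  moreover have "?f ` ?X = coprime_divisor_pairs (a * b)"
  proof (intro equalityI subsetI)
    fix s assume "s \<in> ?f ` ?X"
    then obtain x y z w where s: "s = (x * z, y * w)" "x dvd a" "y dvd a" "coprime x y"
      "z dvd b" "w dvd b" "coprime z w"
      by (auto simp: coprime_divisor_pairs_def)
    \<comment> \<open>The mixed conditions come from the coprimality of \<open>a\<close> and
      \<open>b\<close>, not from that of the pairs.\<close>
    have "coprime x w" "coprime y z"
      using s assms by (auto intro: coprime_divisors)
    with s show "s \<in> coprime_divisor_pairs (a * b)"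
      by (simp add: coprime_divisor_pairs_def mult_dvd_mono coprime_commute)
  next
    fix s assume "s \<in> coprime_divisor_pairs (a * b)"
    then obtain u v where s: "s = (u, v)" "u dvd a * b" "v dvd a * b" "coprime u v"
      by (auto simp: coprime_divisor_pairs_def)
    obtain x z where u: "u = x * z" "x dvd a" "z dvd b"
      using s(2) by (rule dvd_productE)
    obtain y w where v: "v = y * w" "y dvd a" "w dvd b"
      using s(3) by (rule dvd_productE)
    have "((x, y), (z, w)) \<in> ?X"
      using s u v by (auto simp: coprime_divisor_pairs_def)
    then show "s \<in> ?f ` ?X"
      by (rule rev_image_eqI) (simp add: s u v)
  qed
  ultimately show ?thesis
    using card_image[of ?f ?X] by (simp add: card_cartesian_product)
qed

section \<open>Divisor counts for prime powers\<close>

lemma divisors_prime_power: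
  fixes p :: nat
  assumes "prime p"
  shows "{d. d dvd p ^ k} = (\<lambda>i. p ^ i) ` {..k}"
  using assms by (auto simp: divides_primepow_nat image_iff)

lemma inj_prime_power:
  fixes p :: nat
  assumes "prime p"
  shows "inj (\<lambda>i. p ^ i)"
  using prime_gt_1_nat[OF assms] by (auto intro: injI)

lemma card_divisors_prime_power:
  fixes p :: nat
  assumes "prime p"
  shows "card {d. d dvd p ^ k} = k + 1"
  using card_image[OF inj_on_subset[OF inj_prime_power[OF assms] subset_UNIV], of "{..k}"]
  by (simp add: divisors_prime_power[OF assms])

text \<open>Two powers of \<open>p\<close> are coprime only if one of the exponents is 0, so the
  exponent pairs form two arms of an L.\<close>

lemma card_coprime_divisor_pairs_prime_power:
  assumes "prime p"
  shows "card (coprime_divisor_pairs (p ^ k)) = 2 * k + 1"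
proof -
  \<comment> \<open>The second arm starts at 1, so the corner \<open>(0, 0)\<close> is counted once:
    the arms have \<open>k + 1\<close> and \<open>k\<close> elements.\<close>
  let ?I = "{0} \<times> {..k} \<union> {1..k} \<times> {0}"
  let ?f = "\<lambda>(i, j). (p ^ i, p ^ j)"
  have cop: "coprime (p ^ i) (p ^ j) \<longleftrightarrow> i = 0 \<or> j = 0" for i j
    using assms not_prime_unit[of p]
    by (cases "i = 0"; cases "j = 0") (auto simp: coprime_power_left_iff coprime_power_right_iff)
  have image: "coprime_divisor_pairs (p ^ k) = ?f ` ?I"
  proof (intro equalityI image_subsetI, rule subsetI)
    fix s assume "s \<in> coprime_divisor_pairs (p ^ k)"
    then obtain x y where s: "s = (x, y)" "coprime x y"
      "x \<in> {d. d dvd p ^ k}" "y \<in> {d. d dvd p ^ k}"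
      by (auto simp: coprime_divisor_pairs_def)
    then obtain i j where ij: "x = p ^ i" "i \<le> k" "y = p ^ j" "j \<le> k"
      unfolding divisors_prime_power[OF assms] by auto
    with s cop have "(i, j) \<in> ?I"
      by (cases "i = 0") auto
    then show "s \<in> ?f ` ?I"
      by (rule rev_image_eqI) (simp add: s ij)
  next
    fix t assume "t \<in> ?I"
    moreover obtain i j where t: "t = (i, j)" by force
    ultimately have "i \<le> k" "j \<le> k" and "i = 0 \<or> j = 0"
      by auto
    moreover from this have "coprime (p ^ i) (p ^ j)"
      using cop by blast
    ultimately show "?f t \<in> coprime_divisor_pairs (p ^ k)"
      unfolding t coprime_divisor_pairs_def by (simp only: le_imp_power_dvd split mem_Collect_eq)
  qed
  have inj: "inj_on ?f ?I"
  proof (rule inj_onI)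
    fix s t assume "?f s = ?f t"
    then have "p ^ fst s = p ^ fst t" "p ^ snd s = p ^ snd t"
      by (simp_all only: split_beta prod.inject)
    then show "s = t"
      using injD[OF inj_prime_power[OF assms]] by (metis prod_eqI)
  qed
  have "card ?I = card ({0 :: nat} \<times> {..k}) + card ({1..k} \<times> {0 :: nat})"
    by (rule card_Un_disjoint) (simp, simp, force)
  also have "\<dots> = 2 * k + 1"
    by (simp add: card_cartesian_product)
  finally have "card ?I = 2 * k + 1" .
  then show ?thesis
    by (simp only: image card_image[OF inj])
qed

text \<open>Stated for an arbitrary \<open>F\<close> because it serves both the number of divisors
  and the number of coprime pairs. Injectivity of \<open>p\<close> makes each new prime power
  coprime to the product of the earlier ones.\<close>

lemma multiplicative_prod_prime_powers:
  fixes F :: "nat \<Rightarrow> nat"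
  assumes "\<And>a b. coprime a b \<Longrightarrow> F (a * b) = F a * F b" and "F 1 = 1"
    and "finite I" "\<And>i. i \<in> I \<Longrightarrow> prime (p i)" "inj_on p I"
  shows "F (\<Prod>i\<in>I. p i ^ k i) = (\<Prod>i\<in>I. F (p i ^ k i))"
  using assms(3-5)
proof (induction I rule: finite_induct)
  case empty
  then show ?case using assms(2) by simp
next
  case (insert x I)
  have "coprime (p x) (p i)" if "i \<in> I" for i
    using that insert.hyps insert.prems by (intro primes_coprime) (auto simp: inj_on_def)
  then have "coprime (p x ^ k x) (\<Prod>i\<in>I. p i ^ k i)"
    by (intro prod_coprime_right) simp
  with insert assms(1) show ?case
    by simp
qed

section \<open>From ordered to unordered coprime pairs\<close>

lemma card_coprime_divisor_pairs_less:
  assumes "n > 0"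
  shows "card (coprime_divisor_pairs n) =
    2 * card {(x, y). (x, y) \<in> coprime_divisor_pairs n \<and> x < y} + 1"
proof -
  let ?A = "{(x, y). (x, y) \<in> coprime_divisor_pairs n \<and> x < y}"
  have fin: "finite ?A"
    using finite_coprime_divisor_pairs[OF assms] by (rule finite_subset[rotated]) auto
  \<comment> \<open>Coprimality is symmetric, so swapping exchanges the pairs below and above the
    diagonal; on the diagonal, \<open>coprime x x\<close> forces \<open>x = 1\<close>.\<close>
  have "coprime_divisor_pairs n = insert (1, 1) (?A \<union> prod.swap ` ?A)"
  proof (intro equalityI subsetI)
    fix s assume s: "s \<in> coprime_divisor_pairs n"
    obtain x y where xy: "s = (x, y)" by force
    show "s \<in> insert (1, 1) (?A \<union> prod.swap ` ?A)"
      using s unfolding xy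
      by (cases x y rule: linorder_cases)
        (auto simp: coprime_divisor_pairs_def image_iff coprime_commute)
  qed (auto simp: coprime_divisor_pairs_def coprime_commute)
  also have "card \<dots> = Suc (card (?A \<union> prod.swap ` ?A))"
    using fin by (subst card_insert_disjoint) auto
  also have "card (?A \<union> prod.swap ` ?A) = card ?A + card (prod.swap ` ?A)"
    using fin by (subst card_Un_disjoint) auto
  also have "card (prod.swap ` ?A) = card ?A"
    by (simp add: card_image)
  finally show ?thesis by simp
qed

text \<open>The Wiener index sums over two-element sets; each of them has exactly one increasing
  enumeration, so the coprime ones correspond to the pairs with \<open>x < y\<close>.\<close>

lemma card_coprime_doubletons:
  assumes "n > 0"
  shows "card (coprime_divisor_pairs n) =
    2 * card {e. e \<subseteq> {d. d dvd n} \<and> card e = 2 \<and> (\<exists>u v. e = {u, v} \<and> coprime u v)} + 1"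
proof -
  let ?A = "{(x, y). (x, y) \<in> coprime_divisor_pairs n \<and> x < y}"
  let ?E = "{e. e \<subseteq> {d. d dvd n} \<and> card e = 2 \<and> (\<exists>u v. e = {u, v} \<and> coprime u v)}"
  let ?f = "\<lambda>(x, y). {x, y}"
  have "inj_on ?f ?A"
    by (auto intro!: inj_onI simp: doubleton_eq_iff)
  moreover have "?f ` ?A = ?E"
  proof (intro equalityI subsetI)
    fix e assume "e \<in> ?E"
    then obtain u v where e: "e = {u, v}" "coprime u v" "u dvd n" "v dvd n" "u \<noteq> v"
      by (auto simp: card_insert_if split: if_splits)
    then have "(u, v) \<in> ?A \<or> (v, u) \<in> ?A"
      by (auto simp: coprime_divisor_pairs_def coprime_commute)
    moreover have "e = ?f (u, v)" "e = ?f (v, u)"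
      using e(1) by auto
    ultimately show "e \<in> ?f ` ?A"
      by (elim disjE) (rule image_eqI, assumption, assumption)+
  next
    fix e assume "e \<in> ?f ` ?A"
    then obtain u v where "e = {u, v}" "u dvd n" "v dvd n" "coprime u v" "u < v"
      by (auto simp: coprime_divisor_pairs_def)
    then show "e \<in> ?E"
      by auto
  qed
  ultimately have "card ?A = card ?E"
    using card_image[of ?f ?A] by simp
  then show ?thesis
    using card_coprime_divisor_pairs_less[OF assms] by simp
qed

section \<open>Distances in the divisor prime graph\<close>

lemma (in wf_digraph) path_dist_lower_bound:
  assumes "\<And>p. awalk u p v \<Longrightarrow> m \<le> length p"
  shows "ereal m \<le> path_dist u v"
proof -
  have cost: "awalk_cost (\<lambda>_. 1) p = length p" for p :: "'b awalk"
    by (induction p) auto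
  show ?thesis
    unfolding path_dist_def \<mu>_def cost using assms by (auto intro!: INF_greatest)
qed

lemma (in wf_digraph) path_dist_upper_bound:
  assumes "awalk u p v"
  shows "path_dist u v \<le> ereal (length p)"
proof -
  have cost: "awalk_cost (\<lambda>_. 1) p = length p" for p :: "'b awalk"
    by (induction p) auto
  show ?thesis
    unfolding path_dist_def \<mu>_def cost using assms by (auto intro!: INF_lower)
qed

lemma path_dist_divisor_prime_graph:
  assumes "n > 0" "u dvd n" "v dvd n" "u \<noteq> v"
  shows "wf_digraph.path_dist (with_proj (divisor_prime_graph n)) u v =
    (if coprime u v then 1 else 2)"
proof -
  interpret graph "with_proj (divisor_prime_graph n)"
    by (rule graph_divisor_prime_graph) (rule assms)
  have verts: "pverts (divisor_prime_graph n) = {d. d dvd n}"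
    and arcs: "parcs (divisor_prime_graph n) =
      {(x, y). x dvd n \<and> y dvd n \<and> x \<noteq> y \<and> coprime x y}"
    by (simp_all add: divisor_prime_graph_def coprime_iff_gcd_eq_1)
  have arc: "awalk x [(x, y)] y" if "x dvd n" "y dvd n" "x \<noteq> y" "coprime x y" for x y
    using that by (auto simp: awalk_Cons_iff awalk_Nil_iff verts arcs)
  \<comment> \<open>The empty walk would give \<open>u = v\<close>, and a single arc would make
    \<open>u\<close> and \<open>v\<close> coprime, so a walk between non-coprime vertices has at
    least two arcs.\<close>
  have len: "(if coprime u v then 1 else 2) \<le> length p" if p: "awalk u p v" for p
  proof (cases p)
    case Nil
    then show ?thesis using p assms(4) by (auto simp: awalk_Nil_iff)
  next
    case (Cons a q)
    then show ?thesis
      using p by (cases q)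
        (auto simp: awalk_Cons_iff awalk_Nil_iff arcs)
  qed
  have lower: "ereal (if coprime u v then 1 else 2) \<le> path_dist u v"
    using path_dist_lower_bound[of u v "if coprime u v then 1 else 2", OF len]
    by (cases "coprime u v") simp_all
  have upper: "path_dist u v \<le> ereal (if coprime u v then 1 else 2)"
  proof (cases "coprime u v")
    case True
    then show ?thesis
      using path_dist_upper_bound[OF arc[of u v]] assms by simp
  next
    case False
    \<comment> \<open>There are no loops, so the detour through 1 requires both ends to differ from
      1; this holds as 1 is coprime to everything.\<close>
    then have "u \<noteq> 1" "v \<noteq> 1" by auto
    then have "awalk u ([(u, 1)] @ [(1, v)]) v"
      using awalk_appendI[OF arc[of u 1] arc[of 1 v]] assms by simp
    from path_dist_upper_bound[OF this] False show ?thesis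
      by simp
  qed
  from lower upper have "path_dist u v = ereal (if coprime u v then 1 else 2)"
    by (rule antisym[rotated])
  then show ?thesis
    by simp
qed

section \<open>The Wiener index in terms of the two counts\<close>

lemma Wiener_index_divisor_prime_graph:
  assumes "n > 0"
  shows "graph.Wiener_index (with_proj (divisor_prime_graph n)) =
    ereal (real (card {d. d dvd n}) * (real (card {d. d dvd n}) - 1)
      - 1 / 2 * (real (card (coprime_divisor_pairs n)) - 1))"
proof -
  interpret graph "with_proj (divisor_prime_graph n)"
    by (rule graph_divisor_prime_graph) (rule assms)
  let ?V = "{d. d dvd n}"
  let ?P = "{e. e \<subseteq> ?V \<and> card e = 2}"
  let ?Q = "\<lambda>e. \<exists>u v. e = {u, v} \<and> coprime u v"
  have finV: "finite ?V"
    using assms by simp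
  then have finP: "finite ?P"
    by (auto intro: finite_subset[of _ "Pow ?V"])
  \<comment> \<open>Writing the distance as 2 minus an indicator splits the sum into twice the
    number of all pairs minus the number of coprime pairs.\<close>
  have "Wiener_index = (\<Sum>e\<in>?P. ereal (2 - of_bool (?Q e)))"
    unfolding Wiener_index_def
  proof (rule sum.cong)
    show "{e. e \<subseteq> verts (with_proj (divisor_prime_graph n)) \<and> card e = 2} = ?P"
      by (simp add: divisor_prime_graph_def)
    fix e assume "e \<in> ?P"
    then obtain u v where e: "e = {u, v}" "u dvd n" "v dvd n" "u \<noteq> v"
      by (auto simp: card_2_iff)
    \<comment> \<open>The two enumerations of \<open>e\<close> differ only by a swap, so the
      existential in \<open>?Q\<close> can be tested on the chosen one.\<close>
    have "?Q e \<longleftrightarrow> coprime u v"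
      unfolding e(1) by (auto simp: doubleton_eq_iff coprime_commute)
    then show "(THE d. \<exists>u v. e = {u, v} \<and> d = path_dist u v) = ereal (2 - of_bool (?Q e))"
      using path_dist_divisor_prime_graph[OF assms e(2-4)] the_path_dist[of u v] e(1) by simp
  qed
  also have "\<dots> = ereal (2 * real (card ?P) - real (card {e \<in> ?P. ?Q e}))"
    using finP by (simp add: sum_subtractf sum_of_bool_eq Int_def conj_commute)
  also have "card {e \<in> ?P. ?Q e} = card {e. e \<subseteq> ?V \<and> card e = 2 \<and> ?Q e}"
    by (simp add: conj_assoc)
  also have "real \<dots> = 1 / 2 * (real (card (coprime_divisor_pairs n)) - 1)"
    unfolding card_coprime_doubletons[OF assms] by simp
  also have "2 * real (card ?P) = real (card ?V) * (real (card ?V) - 1)"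
  proof -
    \<comment> \<open>The binomial coefficient contains the natural-number difference
      \<open>card ?V - 1\<close>; positivity turns it into a real difference.\<close>
    have "card ?V > 0"
      using finV card_gt_0_iff[of ?V] by auto
    then show ?thesis
      using n_subsets[OF finV, of 2]
      by (simp add: choose_two real_of_nat_div of_nat_diff)
  qed
  finally show ?thesis .
qed

theorem theorem3p1:
  fixes n r D :: nat and p k :: "nat \<Rightarrow> nat"
  assumes "\<And>i. i \<in> {1..r} \<Longrightarrow> prime (p i)"
    and "inj_on p {1..r}"
    and "\<And>i. i \<in> {1..r} \<Longrightarrow> k i \<ge> 1"
    and "n = (\<Prod>i=1..r. p i ^ k i)"
    and "D = (\<Prod>i=1..r. (k i + 1))"
  shows "graph.Wiener_index (with_proj (divisor_prime_graph n)) =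
    ereal (real D * (real D - 1) - 1 / 2 * ((\<Prod>i=1..r. (2 * real (k i) + 1)) - 1))"
proof -
  have "n > 0"
    unfolding assms(4) using assms(1) by (intro prod_pos) (auto simp: prime_gt_0_nat)
  have "card {d. d dvd n} = (\<Prod>i=1..r. card {d. d dvd p i ^ k i})"
    unfolding assms(4)
    by (rule multiplicative_prod_prime_powers) (use assms in \<open>auto simp: card_divisors_mult\<close>)
  also have "\<dots> = D"
    unfolding assms(5) using assms(1) by (intro prod.cong) (auto simp: card_divisors_prime_power)
  finally have D: "card {d. d dvd n} = D" .
  \<comment> \<open>This supplies the value 1 at the empty product, the base case of the
    multiplicativity argument.\<close>
  have "coprime_divisor_pairs 1 = {(1, 1)}"
    by (auto simp: coprime_divisor_pairs_def)
  then have "card (coprime_divisor_pairs n) = (\<Prod>i=1..r. card (coprime_divisor_pairs (p i ^ k i)))"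
    unfolding assms(4)
    by (intro multiplicative_prod_prime_powers)
      (use assms in \<open>auto simp: card_coprime_divisor_pairs_mult\<close>)
  also have "\<dots> = (\<Prod>i=1..r. 2 * k i + 1)"
    using assms(1) by (intro prod.cong) (auto simp: card_coprime_divisor_pairs_prime_power)
  finally have "real (card (coprime_divisor_pairs n)) = (\<Prod>i=1..r. 2 * real (k i) + 1)"
    by (simp add: add.commute)
  with Wiener_index_divisor_prime_graph[OF \<open>n > 0\<close>] D show ?thesis
    by simp
qed

end
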